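(* Let $\Phi=(G,\varphi)$ be a complex unit gain graph with $n$ vertices and $m\ge 1$ edges, and let $\chi$ be the chromatic number of $G$. For every $\gamma\in\mathbb{R}$ one has $$\lambda_1(\Phi)\le \frac{2m}{n}\left(a(\Phi)-\frac{(\gamma-1)^2(a(\Phi)-1)}{\chi+\gamma^2-1}\right),$$ and the optimal (i.e. smallest over $\gamma\in\mathbb{R}$) bound of this form is $$\lambda_1(\Phi)\le\begin{cases}\dfrac{2m}{n}\,a(\Phi) & \text{if } 0\le a(\Phi)\le 1,\\[2mm] \dfrac{2m}{n}\left(1-\dfrac{a(\Phi)-1}{\chi-1}\right) & \text{if } 1<a(\Phi)\le 2;\end{cases}$$ that is, the last right-hand side equals the minimum over $\gamma\in\mathbb{R}$ of the first right-hand side, and it is an upper bound for $\lambda_1(\Phi)$.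
   Context: A complex unit gain graph ($\mathbb{T}$-gain graph) $\Phi=(G,\varphi)$ consists of a finite simple undirected graph $G$ with vertices $v_1,\dots,v_n$ and a map $\varphi$ assigning to each oriented edge $\overrightarrow{e}_{ij}$ (from $v_i$ to $v_j$, where $v_i\sim v_j$) a complex number of modulus $1$, with $\varphi(\overrightarrow{e}_{ji})=\varphi(\overrightarrow{e}_{ij})^{-1}$. Its adjacency matrix $\mathbf{A}(\Phi)=(a_{ij})$ has $a_{ij}=\varphi(\overrightarrow{e}_{ij})$ if $v_i\sim v_j$ and $a_{ij}=0$ otherwise. The gain Laplacian is $\mathbf{L}(\Phi)=\mathbf{D}(G)-\mathbf{A}(\Phi)$, where $\mathbf{D}(G)$ is the diagonal matrix of vertex degrees of $G$; it is Hermitian positive semidefinite and $\lambda_1(\Phi)$ denotes its smallest eigenvalue. Define $$a(\Phi)=\frac1m\sum_{v_i\sim v_j,\ i<j}\bigl(1-\operatorname{Re}(a_{ij})\bigr).$$ *)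

theory Defs
  imports Complex_Main "Jordan_Normal_Form.Spectral_Radius"
begin

text \<open>
  The vertices $v_1, \dots, v_n$ are the naturals below \<open>n\<close> (shifted by one, to match the
  indices of matrices), and an undirected edge is the two-element set of its ends.
\<close>

locale simple_graph =
  fixes n :: nat and E :: "nat set set"
  assumes edges: "e \<in> E \<Longrightarrow> e \<subseteq> {..<n} \<and> card e = 2"

text \<open>
  \<open>\<phi> i j\<close> is the gain of the edge oriented from \<open>i\<close> to \<open>j\<close>; its values at non-adjacent
  pairs are irrelevant.
\<close>

locale unit_gain_graph = simple_graph n E
  for n :: nat and E :: "nat set set" +
  fixes \<phi> :: "nat \<Rightarrow> nat \<Rightarrow> complex"
  assumes gain_unit: "{i, j} \<in> E \<Longrightarrow> cmod (\<phi> i j) = 1"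
    and gain_reverse: "{i, j} \<in> E \<Longrightarrow> \<phi> j i = inverse (\<phi> i j)"

definition vertex_degree :: "nat set set \<Rightarrow> nat \<Rightarrow> nat" where
  "vertex_degree E i = card {j. {i, j} \<in> E}"

definition degree_matrix :: "nat \<Rightarrow> nat set set \<Rightarrow> complex mat" where
  "degree_matrix n E = mat n n (\<lambda>(i, j). if i = j then of_nat (vertex_degree E i) else 0)"

definition gain_adjacency :: "nat \<Rightarrow> nat set set \<Rightarrow> (nat \<Rightarrow> nat \<Rightarrow> complex) \<Rightarrow> complex mat" where
  "gain_adjacency n E \<phi> = mat n n (\<lambda>(i, j). if {i, j} \<in> E then \<phi> i j else 0)"

definition gain_laplacian :: "nat \<Rightarrow> nat set set \<Rightarrow> (nat \<Rightarrow> nat \<Rightarrow> complex) \<Rightarrow> complex mat" where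
  "gain_laplacian n E \<phi> = degree_matrix n E - gain_adjacency n E \<phi>"

text \<open>
  Meaningful for Hermitian matrices of positive dimension: their spectrum is a nonempty finite
  set of real numbers, so \<open>Re\<close> only changes the type.
\<close>

definition smallest_eigenvalue :: "complex mat \<Rightarrow> real" where
  "smallest_eigenvalue A = Min (Re ` spectrum A)"

definition mean_gain_defect :: "nat \<Rightarrow> nat set set \<Rightarrow> (nat \<Rightarrow> nat \<Rightarrow> complex) \<Rightarrow> real" where
  "mean_gain_defect n E \<phi> =
     1 / real (card E) *
     (\<Sum>(i, j) \<in> {(i, j). i < j \<and> j < n \<and> {i, j} \<in> E}. 1 - Re (gain_adjacency n E \<phi> $$ (i, j)))"

definition proper_colouring :: "nat \<Rightarrow> nat set set \<Rightarrow> nat \<Rightarrow> (nat \<Rightarrow> nat) \<Rightarrow> bool" where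
  "proper_colouring n E k c \<longleftrightarrow>
     (\<forall>i<n. c i < k) \<and> (\<forall>i j. {i, j} \<in> E \<longrightarrow> c i \<noteq> c j)"

definition chromatic_number :: "nat \<Rightarrow> nat set set \<Rightarrow> nat" where
  "chromatic_number n E = (LEAST k. \<exists>c. proper_colouring n E k c)"

end

theory Submission
  imports Defs "HOL-Analysis.L2_Norm"
begin

text \<open>
  The form of \<open>L\<close> at a real vector \<open>x\<close> is the sum of \<open>x i\<^sup>2 - Re (\<phi> i j) x i x j\<close> over the
  oriented edges, and it dominates \<open>\<lambda>\<^sub>1 \<Sum> x i\<^sup>2\<close>. The all-ones vector yields \<open>2 m a / n\<close>. For a
  proper colouring with \<open>\<chi>\<close> colours, giving one colour class the weight \<open>\<gamma> = 1 - \<chi>\<close> and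
  averaging over the classes yields the bound for \<open>a > 1\<close>. The minimum over \<open>\<gamma>\<close> is found from
  \<open>(\<gamma> - 1)\<^sup>2 \<le> (\<gamma>\<^sup>2 + s) (1 + 1 / s)\<close> for \<open>s = \<chi> - 1\<close>, with equality at \<open>\<gamma> = - s\<close>.

  Self-adjoint matrices need not be diagonalised for the Rayleigh bound: the boundedness of the
  powers of a matrix of spectral radius less than one suffices.
\<close>

section \<open>The Rayleigh bound for self-adjoint matrices\<close>

lemma cscalar_prod_self:
  fixes v :: "complex vec"
  assumes "v \<in> carrier_vec n"
  shows "v \<bullet>c v = of_real (\<Sum>i<n. (cmod (v $ i))\<^sup>2)"
  using assms
  by (auto simp: scalar_prod_def atLeast0LessThan complex_norm_square simp del: of_real_power intro!: sum.cong)

lemma cscalar_prod_Cauchy_Schwarz: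
  fixes v w :: "complex vec"
  assumes v: "v \<in> carrier_vec n" and w: "w \<in> carrier_vec n"
  shows "(Re (v \<bullet>c w))\<^sup>2 \<le> Re (v \<bullet>c v) * Re (w \<bullet>c w)"
proof -
  let ?L = "\<lambda>u :: complex vec. L2_set (\<lambda>i. cmod (u $ i)) {..<n}"
  have self: "Re (u \<bullet>c u) = (?L u)\<^sup>2" if "u \<in> carrier_vec n" for u
    unfolding cscalar_prod_self[OF that] L2_set_def by (simp add: sum_nonneg)
  have "v \<bullet>c w = (\<Sum>i<n. v $ i * cnj (w $ i))"
    using v w by (auto simp: scalar_prod_def atLeast0LessThan intro!: sum.cong)
  then have "\<bar>Re (v \<bullet>c w)\<bar> \<le> cmod (\<Sum>i<n. v $ i * cnj (w $ i))" by (metis abs_Re_le_cmod)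
  also have "\<dots> \<le> (\<Sum>i<n. \<bar>cmod (v $ i)\<bar> * \<bar>cmod (w $ i)\<bar>)"
    by (rule order_trans[OF norm_sum]) (simp add: norm_mult)
  also have "\<dots> \<le> ?L v * ?L w" by (rule L2_set_mult_ineq)
  finally have "\<bar>Re (v \<bullet>c w)\<bar>\<^sup>2 \<le> (?L v * ?L w)\<^sup>2" by (rule power_mono) simp
  then show ?thesis by (simp add: self[OF v] self[OF w] power_mult_distrib)
qed

lemma mult_mat_vec_cscalar_prod:
  fixes A :: "complex mat"
  assumes "A \<in> carrier_mat n n" "v \<in> carrier_vec n" "w \<in> carrier_vec n"
  shows "(A *\<^sub>v v) \<bullet>c w = (\<Sum>i<n. \<Sum>j<n. A $$ (i, j) * v $ j * cnj (w $ i))"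
  using assms by (auto simp: scalar_prod_def atLeast0LessThan sum_distrib_right intro!: sum.cong)

section \<open>Self-adjoint matrices and their powers\<close>

text \<open>Phrased through the inner product rather than the entries, so that factors of a power
  can be moved across it.\<close>

definition self_adjoint :: "nat \<Rightarrow> complex mat \<Rightarrow> bool" where
  "self_adjoint n A \<longleftrightarrow> A \<in> carrier_mat n n \<and>
     (\<forall>v \<in> carrier_vec n. \<forall>w \<in> carrier_vec n. (A *\<^sub>v v) \<bullet>c w = v \<bullet>c (A *\<^sub>v w))"

lemma self_adjointI_entries:
  assumes A: "A \<in> carrier_mat n n"
    and sym: "\<And>i j. i < n \<Longrightarrow> j < n \<Longrightarrow> A $$ (j, i) = cnj (A $$ (i, j))"
  shows "self_adjoint n A"
  unfolding self_adjoint_def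
proof (intro conjI A ballI)
  fix v w :: "complex vec" assume v: "v \<in> carrier_vec n" and w: "w \<in> carrier_vec n"
  have "v \<bullet>c (A *\<^sub>v w) = (\<Sum>j<n. \<Sum>i<n. v $ j * (cnj (A $$ (j, i)) * cnj (w $ i)))"
    using A v w by (auto simp: scalar_prod_def atLeast0LessThan sum_distrib_left intro!: sum.cong)
  also have "\<dots> = (\<Sum>j<n. \<Sum>i<n. A $$ (i, j) * v $ j * cnj (w $ i))"
    by (intro sum.cong) (auto simp: sym[symmetric])
  also have "\<dots> = (\<Sum>i<n. \<Sum>j<n. A $$ (i, j) * v $ j * cnj (w $ i))"
    by (rule sum.swap)
  finally show "(A *\<^sub>v v) \<bullet>c w = v \<bullet>c (A *\<^sub>v w)"
    by (simp add: mult_mat_vec_cscalar_prod[OF A v w])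
qed

lemma pow_mat_add:
  assumes A: "A \<in> carrier_mat n n"
  shows "A ^\<^sub>m (k + l) = A ^\<^sub>m k * A ^\<^sub>m l"
  by (induction l) (use A in \<open>auto simp: assoc_mult_mat[of _ n n _ n _ n]\<close>)

lemma self_adjoint_pow:
  assumes "self_adjoint n A"
  shows "self_adjoint n (A ^\<^sub>m k)"
proof (induction k)
  case 0
  then show ?case using assms by (auto simp: self_adjoint_def)
next
  case (Suc k)
  have A: "A \<in> carrier_mat n n" using assms by (simp add: self_adjoint_def)
  have P: "A ^\<^sub>m k \<in> carrier_mat n n" using A by simp
  have comm: "A ^\<^sub>m k * A = A * A ^\<^sub>m k"
    using pow_mat_add[OF A, of 1 k] pow_mat_add[OF A, of k 1] A by simp
  show ?case
    unfolding self_adjoint_def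
  proof (intro conjI ballI)
    fix v w :: "complex vec" assume v: "v \<in> carrier_vec n" and w: "w \<in> carrier_vec n"
    have "(A ^\<^sub>m Suc k *\<^sub>v v) \<bullet>c w = (A ^\<^sub>m k *\<^sub>v (A *\<^sub>v v)) \<bullet>c w"
      using A P v by (simp add: assoc_mult_mat_vec[of _ n n _ n])
    also have "\<dots> = (A *\<^sub>v v) \<bullet>c (A ^\<^sub>m k *\<^sub>v w)"
      using Suc A v w unfolding self_adjoint_def by simp
    also have "\<dots> = v \<bullet>c (A *\<^sub>v (A ^\<^sub>m k *\<^sub>v w))"
      using assms P v w unfolding self_adjoint_def by (metis mult_mat_vec_carrier)
    also have "A *\<^sub>v (A ^\<^sub>m k *\<^sub>v w) = A ^\<^sub>m Suc k *\<^sub>v w"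
      using A P w comm by (metis assoc_mult_mat_vec pow_mat.simps(2))
    finally show "(A ^\<^sub>m Suc k *\<^sub>v v) \<bullet>c w = v \<bullet>c (A ^\<^sub>m Suc k *\<^sub>v w)" .
  qed (use A P in auto)
qed

text \<open>At an eigenvector the two sides of self-adjointness are \<open>k\<close> and
  \<open>cnj k\<close> times the same nonzero number.\<close>

lemma self_adjoint_eigenvalue_real:
  assumes A: "self_adjoint n A" and k: "eigenvalue A k"
  shows "k \<in> \<real>"
proof -
  have carrier: "A \<in> carrier_mat n n" using A by (simp add: self_adjoint_def)
  obtain v where v: "v \<in> carrier_vec n" "v \<noteq> 0\<^sub>v n" "A *\<^sub>v v = k \<cdot>\<^sub>v v"
    using k carrier by (auto simp: eigenvalue_def eigenvector_def)
  have "k * (v \<bullet>c v) = (A *\<^sub>v v) \<bullet>c v" using v by simp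
  also have "\<dots> = v \<bullet>c (A *\<^sub>v v)" using A v unfolding self_adjoint_def by blast
  also have "\<dots> = cnj k * (v \<bullet>c v)" using v by (simp add: conjugate_smult_vec)
  finally have "k = cnj k" using v by simp
  then show ?thesis by (simp add: Reals_cnj_iff)
qed

section \<open>The Rayleigh bound from bounded powers\<close>

text \<open>The factor of \<open>C\<close> depends on \<open>v\<close> alone, so entries bounded
  uniformly over all powers of a matrix give uniformly bounded forms.\<close>

lemma norm_bound_cscalar_prod:
  fixes A :: "complex mat"
  assumes A: "A \<in> carrier_mat n n" and v: "v \<in> carrier_vec n" and "norm_bound A C"
  shows "Re ((A *\<^sub>v v) \<bullet>c v) \<le> C * (\<Sum>i<n. \<Sum>j<n. cmod (v $ j) * cmod (v $ i))"
proof -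
  have "Re ((A *\<^sub>v v) \<bullet>c v) \<le> cmod (\<Sum>i<n. \<Sum>j<n. A $$ (i, j) * v $ j * cnj (v $ i))"
    unfolding mult_mat_vec_cscalar_prod[OF A v v] by (rule complex_Re_le_cmod)
  also have "\<dots> \<le> (\<Sum>i<n. \<Sum>j<n. C * (cmod (v $ j) * cmod (v $ i)))"
    using assms by (intro sum_norm_le) 
      (auto simp: norm_bound_def norm_mult mult.assoc intro!: mult_right_mono)
  finally show ?thesis by (simp add: sum_distrib_left)
qed

text \<open>
  Along the powers \<open>A\<^bsup>2^k\<^esup>\<close> the normalised quadratic form is at least squared in each step,
  whereas the powers of a matrix of spectral radius less than one stay bounded.
\<close>

lemma self_adjoint_form_le:
  assumes A: "self_adjoint n A" and sr: "spectral_radius A < 1" and v: "v \<in> carrier_vec n"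
  shows "Re ((A *\<^sub>v v) \<bullet>c v) \<le> Re (v \<bullet>c v)"
proof (rule ccontr)
  assume less: "\<not> ?thesis"
  define N where "N = Re (v \<bullet>c v)"
  define f where "f k = Re ((A ^\<^sub>m k *\<^sub>v v) \<bullet>c v)" for k
  have carrier: "A \<in> carrier_mat n n" using A by (simp add: self_adjoint_def)
  have "v \<noteq> 0\<^sub>v n" using less carrier by auto
  then have "v \<bullet>c v > 0" using v by simp
  then have N: "N > 0" by (simp add: N_def less_complex_def)
  define q where "q = f 1 / N"
  have "q > 1" using less N carrier by (simp add: q_def f_def N_def)
  have growth: "N * q ^ (2 ^ k) \<le> f (2 ^ k)" for k
  proof (induction k)
    case 0
    then show ?case using N by (simp add: q_def)
  next
    case (Suc k)
    let ?w = "A ^\<^sub>m (2 ^ k) *\<^sub>v v"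
    have P: "A ^\<^sub>m (2 ^ k) \<in> carrier_mat n n" using carrier by simp
    have w: "?w \<in> carrier_vec n" using P v by simp
    have "A ^\<^sub>m (2 ^ Suc k) = A ^\<^sub>m (2 ^ k) * A ^\<^sub>m (2 ^ k)"
      using pow_mat_add[OF carrier, of "2 ^ k" "2 ^ k"] by (simp add: mult_2)
    then have "(A ^\<^sub>m (2 ^ Suc k) *\<^sub>v v) \<bullet>c v = (A ^\<^sub>m (2 ^ k) *\<^sub>v ?w) \<bullet>c v"
      using P v by (simp add: assoc_mult_mat_vec[of _ n n _ n])
    \<comment> \<open>Half of the factors move to the other side; Cauchy-Schwarz for
      \<open>?w\<close> and \<open>v\<close> then bounds the square of the previous form.\<close>
    also have "\<dots> = ?w \<bullet>c ?w"
      using self_adjoint_pow[OF A, of "2 ^ k"] v w unfolding self_adjoint_def by blast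
    finally have "(f (2 ^ k))\<^sup>2 \<le> f (2 ^ Suc k) * N"
      using cscalar_prod_Cauchy_Schwarz[OF w v] by (simp add: f_def N_def)
    moreover have "(N * q ^ (2 ^ k))\<^sup>2 \<le> (f (2 ^ k))\<^sup>2"
      using Suc N \<open>q > 1\<close> by (intro power_mono) auto
    ultimately have "N * (N * q ^ (2 ^ Suc k)) \<le> N * f (2 ^ Suc k)"
      by (simp add: power_mult_distrib power_mult[symmetric] power2_eq_square[of N] mult_ac)
    then show ?case using N by simp
  qed
  obtain C where C: "norm_bound (A ^\<^sub>m k) C" for k
    using spectral_radius_jnf_norm_bound_less_1_upper_triangular[OF carrier sr] by blast
  let ?S = "\<Sum>i<n. \<Sum>j<n. cmod (v $ j) * cmod (v $ i)"
  have bounded: "f k \<le> C * ?S" for k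
    unfolding f_def using carrier v C by (intro norm_bound_cscalar_prod) auto
  \<comment> \<open>Since \<open>q > 1\<close>, its powers pass every bound;
    \<open>k \<le> 2 ^ k\<close> carries this over to the exponents for which growth is
    known.\<close>
  obtain k where k: "C * ?S / N < q ^ k" using real_arch_pow[OF \<open>q > 1\<close>] by blast
  have "q ^ k \<le> q ^ (2 ^ k)"
    using \<open>q > 1\<close> by (intro power_increasing) (auto intro: less_imp_le)
  with k have "C * ?S / N < q ^ (2 ^ k)" by linarith
  then have "C * ?S < N * q ^ (2 ^ k)" using N by (simp add: pos_divide_less_eq mult.commute)
  with growth[of k] bounded[of "2 ^ k"] show False by linarith
qed

text \<open>
  If the form of \<open>A\<close> were smaller at \<open>v\<close>, a matrix \<open>(c I - A) / s\<close> would have its spectrum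
  in \<open>[0, 1)\<close> and yet a form exceeding \<open>v \<bullet>c v\<close>.
\<close>

theorem smallest_eigenvalue_le_form:
  assumes A: "self_adjoint n A" and v: "v \<in> carrier_vec n"
  shows "smallest_eigenvalue A * Re (v \<bullet>c v) \<le> Re ((A *\<^sub>v v) \<bullet>c v)"
proof (cases "v = 0\<^sub>v n")
  case True
  then show ?thesis using A by (auto simp: self_adjoint_def)
next
  case False
  define N where "N = Re (v \<bullet>c v)"
  define l where "l = smallest_eigenvalue A"
  define c where "c = Max (Re ` spectrum A)"
  define \<rho> where "\<rho> = Re ((A *\<^sub>v v) \<bullet>c v) / N"
  define s where "s = c - (\<rho> + l) / 2"
  define B where "B = of_real (1 / s) \<cdot>\<^sub>m (of_real c \<cdot>\<^sub>m 1\<^sub>m n - A)"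
  have carrier: "A \<in> carrier_mat n n" using A by (simp add: self_adjoint_def)
  \<comment> \<open>A positive dimension makes the spectrum nonempty, so that \<open>Min\<close> and
    \<open>Max\<close> in \<open>l\<close> and \<open>c\<close> are genuine extrema.\<close>
  have "n > 0" using False v by (cases "n = 0") auto
  have "v \<bullet>c v > 0" using v False by simp
  then have N: "N > 0" by (simp add: N_def less_complex_def)
  have spec: "finite (Re ` spectrum A)" "Re ` spectrum A \<noteq> {}"
    using card_finite_spectrum[OF carrier] spectrum_non_empty[OF carrier \<open>n > 0\<close>] by auto
  have between: "l \<le> Re k \<and> Re k \<le> c" if "k \<in> spectrum A" for k
    using that spec by (auto simp: l_def smallest_eigenvalue_def c_def)
  then have "l \<le> c" using spec by fastforce
  have Bc: "B \<in> carrier_mat n n" unfolding B_def using carrier by auto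
  have Bv: "B *\<^sub>v w = of_real (1 / s) \<cdot>\<^sub>v (of_real c \<cdot>\<^sub>v w - A *\<^sub>v w)"
    if w: "w \<in> carrier_vec n" for w
  proof -
    have "B *\<^sub>v w = of_real (1 / s) \<cdot>\<^sub>v ((of_real c \<cdot>\<^sub>m 1\<^sub>m n - A) *\<^sub>v w)"
      unfolding B_def using carrier w by (intro eq_vecI) auto
    also have "(of_real c \<cdot>\<^sub>m 1\<^sub>m n - A) *\<^sub>v w = (of_real c \<cdot>\<^sub>m 1\<^sub>m n) *\<^sub>v w - A *\<^sub>v w"
      using carrier w by (intro minus_mult_distrib_mat_vec) auto
    also have "(of_real c \<cdot>\<^sub>m 1\<^sub>m n) *\<^sub>v w = complex_of_real c \<cdot>\<^sub>v w"
      using w by (intro eq_vecI) auto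
    finally show ?thesis .
  qed
  show ?thesis
  proof (rule ccontr)
    assume "\<not> ?thesis"
    then have "\<rho> < l" using N by (simp add: \<rho>_def l_def N_def field_simps)
    \<comment> \<open>The midpoint puts \<open>s\<close> strictly between \<open>c - l\<close> and
      \<open>c - \<rho>\<close>: the first inequality keeps the eigenvalues of \<open>B\<close>
      below 1, the last makes its form at \<open>v\<close> exceed \<open>N\<close>.\<close>
    then have s: "s > c - l" "s > 0" "s < c - \<rho>" using \<open>l \<le> c\<close> by (auto simp: s_def field_simps)
    have saB: "self_adjoint n B"
      unfolding self_adjoint_def
    proof (intro conjI Bc ballI)
      fix u w :: "complex vec" assume u: "u \<in> carrier_vec n" and w: "w \<in> carrier_vec n"
      have [simp]: "A *\<^sub>v u \<in> carrier_vec n" "A *\<^sub>v w \<in> carrier_vec n" using carrier u w by auto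
      have eq: "(A *\<^sub>v u) \<bullet>c w = u \<bullet>c (A *\<^sub>v w)" using A u w unfolding self_adjoint_def by blast
      have "(B *\<^sub>v u) \<bullet>c w = of_real (1 / s) * (of_real c * (u \<bullet>c w) - (A *\<^sub>v u) \<bullet>c w)"
        using u w by (simp add: Bv minus_scalar_prod_distrib[of _ n] smult_scalar_prod_distrib[of _ n])
      also have "\<dots> = u \<bullet>c (B *\<^sub>v w)"
      proof -
        have "conjugate (of_real c \<cdot>\<^sub>v w - A *\<^sub>v w) = of_real c \<cdot>\<^sub>v conjugate w - conjugate (A *\<^sub>v w)"
          using w carrier by (intro eq_vecI) auto
        then show ?thesis using u w 
          by (simp add: Bv conjugate_smult_vec scalar_prod_minus_distrib[of _ n] scalar_prod_smult_distrib[of _ n] eq)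
      qed
      finally show "(B *\<^sub>v u) \<bullet>c w = u \<bullet>c (B *\<^sub>v w)" .
    qed
    have "spectral_radius B < 1"
    proof -
      obtain k where k: "k \<in> spectrum B" "spectral_radius B = cmod k"
        using spectral_radius_mem_max(1)[OF Bc \<open>n > 0\<close>] by auto
      then obtain w where w: "w \<in> carrier_vec n" "w \<noteq> 0\<^sub>v n" "B *\<^sub>v w = k \<cdot>\<^sub>v w"
        using Bc by (auto simp: spectrum_def eigenvalue_def eigenvector_def)
      \<comment> \<open>Undoing the affine map turns the eigenvalue \<open>k\<close> of
        \<open>B\<close> into the eigenvalue \<open>c - s k\<close> of \<open>A\<close>, which lies
        between \<open>l\<close> and \<open>c\<close>.\<close>
      have "A *\<^sub>v w = (of_real c - of_real s * k) \<cdot>\<^sub>v w"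
      proof (intro eq_vecI)
        fix i assume i: "i < dim_vec ((of_real c - of_real s * k) \<cdot>\<^sub>v w)"
        then have "(B *\<^sub>v w) $ i = k * w $ i" by (simp add: w)
        moreover have "(B *\<^sub>v w) $ i = of_real (1 / s) * (of_real c * w $ i - (A *\<^sub>v w) $ i)"
          unfolding Bv[OF w(1)] using w(1) i carrier by simp
        ultimately show "(A *\<^sub>v w) $ i = ((of_real c - of_real s * k) \<cdot>\<^sub>v w) $ i"
          using i s by (simp add: field_simps)
      qed (use carrier w in auto)
      then have "of_real c - of_real s * k \<in> spectrum A"
        using w carrier by (auto simp: spectrum_def eigenvalue_def eigenvector_def)
      from between[OF this] have "s * Re k \<le> c - l" "0 \<le> s * Re k" by auto
      then have "s * Re k < s * 1" "0 \<le> s * Re k" using s by linarith+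
      then have "Re k < 1" "0 \<le> Re k" using s by (auto simp: zero_le_mult_iff)
      \<comment> \<open>Only the real part of \<open>k\<close> is bounded so far; realness turns
        this into a bound on the modulus.\<close>
      moreover have "k \<in> \<real>"
        using self_adjoint_eigenvalue_real[OF saB] k by (simp add: spectrum_def)
      ultimately show ?thesis using k by (auto simp: elim!: Reals_cases)
    qed
    from self_adjoint_form_le[OF saB this v] have "Re ((B *\<^sub>v v) \<bullet>c v) \<le> N"
      by (simp add: N_def)
    moreover have "(B *\<^sub>v v) \<bullet>c v = of_real (1 / s) * (of_real c * (v \<bullet>c v) - (A *\<^sub>v v) \<bullet>c v)"
      using v carrier by (simp add: Bv minus_scalar_prod_distrib[of _ n] smult_scalar_prod_distrib[of _ n])
    then have "Re ((B *\<^sub>v v) \<bullet>c v) = (c * N - \<rho> * N) / s"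
      using N by (simp add: N_def \<rho>_def Re_divide_of_real)
    ultimately have "(c - \<rho>) * N \<le> s * N" using s by (simp add: field_simps)
    then show False using s N by simp
  qed
qed


section \<open>The form of the gain Laplacian\<close>

definition arcs :: "nat set set \<Rightarrow> (nat \<times> nat) set" where
  "arcs E = {(i, j). {i, j} \<in> E}"

definition ascending_arcs :: "nat set set \<Rightarrow> (nat \<times> nat) set" where
  "ascending_arcs E = {(i, j). i < j \<and> {i, j} \<in> E}"

context simple_graph
begin

lemma edgeD:
  assumes "{i, j} \<in> E"
  shows "i < n" "j < n" "i \<noteq> j"
  using edges[OF assms] by (auto simp: card_insert_if)

lemma finite_arcs: "finite (arcs E)"
  by (rule finite_subset[of _ "{..<n} \<times> {..<n}"]) (auto simp: arcs_def edgeD)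

lemma finite_ascending_arcs: "finite (ascending_arcs E)"
  using finite_arcs by (rule finite_subset[rotated]) (auto simp: arcs_def ascending_arcs_def)

lemma card_ascending_arcs: "card (ascending_arcs E) = card E"
proof (rule bij_betw_same_card)
  show "bij_betw (\<lambda>(i, j). {i, j}) (ascending_arcs E) E"
    unfolding bij_betw_def
  proof
    show "inj_on (\<lambda>(i, j). {i, j}) (ascending_arcs E)"
      by (auto simp: inj_on_def ascending_arcs_def doubleton_eq_iff)
    have "e \<in> (\<lambda>(i, j). {i, j}) ` ascending_arcs E" if e: "e \<in> E" for e
    proof -
      obtain i j where ij: "e = {i, j}" "i \<noteq> j" using edges[OF e] by (auto simp: card_2_iff)
      then have "(i, j) \<in> ascending_arcs E \<or> (j, i) \<in> ascending_arcs E"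
        using e by (auto simp: ascending_arcs_def insert_commute)
      then show ?thesis using ij by (auto simp: image_iff insert_commute)
    qed
    then show "(\<lambda>(i, j). {i, j}) ` ascending_arcs E = E" by (auto simp: ascending_arcs_def)
  qed
qed

text \<open>The arcs are the ascending ones together with their reversals, and the two halves
  contribute equally.\<close>

lemma sum_arcs:
  fixes g :: "nat \<Rightarrow> nat \<Rightarrow> real"
  assumes sym: "\<And>i j. {i, j} \<in> E \<Longrightarrow> g j i = g i j"
  shows "(\<Sum>(i, j)\<in>arcs E. g i j) = 2 * (\<Sum>(i, j)\<in>ascending_arcs E. g i j)"
proof -
  have "arcs E = ascending_arcs E \<union> prod.swap ` ascending_arcs E"
    by (force simp: arcs_def ascending_arcs_def insert_commute dest: edgeD(3))
  then have "(\<Sum>(i, j)\<in>arcs E. g i j) =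
      (\<Sum>(i, j)\<in>ascending_arcs E. g i j) + (\<Sum>(i, j)\<in>prod.swap ` ascending_arcs E. g i j)"
    by (simp only:) (rule sum.union_disjoint; 
        auto simp: finite_ascending_arcs; auto simp: ascending_arcs_def)
  also have "(\<Sum>(i, j)\<in>prod.swap ` ascending_arcs E. g i j) = (\<Sum>(i, j)\<in>ascending_arcs E. g i j)"
    by (subst sum.reindex) (auto simp: ascending_arcs_def sym intro!: sum.cong)
  finally show ?thesis by simp
qed

lemma card_arcs: "card (arcs E) = 2 * card E"
  using sum_arcs[of "\<lambda>_ _. 1"] by (simp add: card_ascending_arcs)

text \<open>Giving every vertex its own colour is proper, so the minimum in the definition is
  attained.\<close>

lemma proper_colouring_chromatic_number:
  "\<exists>c. proper_colouring n E (chromatic_number n E) c"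
  unfolding chromatic_number_def
proof (rule LeastI_ex)
  have "proper_colouring n E n id" by (auto simp: proper_colouring_def dest: edgeD)
  then show "\<exists>k c. proper_colouring n E k c" by blast
qed

end

section \<open>The quadratic form and the mean gain defect\<close>

context unit_gain_graph
begin

text \<open>On the unit circle the inverse is the conjugate. This makes the Laplacian Hermitian and
  \<open>Re (\<phi> i j)\<close> symmetric in \<open>i\<close> and \<open>j\<close>.\<close>

lemma gain_reverse_cnj:
  assumes "{i, j} \<in> E"
  shows "\<phi> j i = cnj (\<phi> i j)"
proof -
  have "\<phi> i j * cnj (\<phi> i j) = 1"
    using gain_unit[OF assms] complex_norm_square[of "\<phi> i j"] by simp
  then show ?thesis using gain_reverse[OF assms] inverse_unique by metis
qed

lemma self_adjoint_gain_laplacian: "self_adjoint n (gain_laplacian n E \<phi>)"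
proof (rule self_adjointI_entries)
  show "gain_laplacian n E \<phi> $$ (j, i) = cnj (gain_laplacian n E \<phi> $$ (i, j))"
    if "i < n" "j < n" for i j
    using that gain_reverse_cnj[of i j]
    by (auto simp: gain_laplacian_def degree_matrix_def gain_adjacency_def insert_commute)
qed (auto simp: gain_laplacian_def degree_matrix_def gain_adjacency_def)

text \<open>The degree of \<open>i\<close> counts the arcs leaving \<open>i\<close>, so the diagonal
  entry supplies one \<open>(x i)\<^sup>2\<close> to each of them.\<close>

lemma gain_laplacian_form:
  fixes x :: "nat \<Rightarrow> real"
  defines "v \<equiv> vec n (\<lambda>i. complex_of_real (x i))"
  shows "Re ((gain_laplacian n E \<phi> *\<^sub>v v) \<bullet>c v) =
    (\<Sum>(i, j)\<in>arcs E. (x i)\<^sup>2 - Re (\<phi> i j) * (x i * x j))"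
proof -
  let ?L = "gain_laplacian n E \<phi>" and ?N = "\<lambda>i. {j. {i, j} \<in> E}"
  have L: "?L \<in> carrier_mat n n"
    by (auto simp: gain_laplacian_def degree_matrix_def gain_adjacency_def)
  have fin: "finite (?N i)" for i
    by (rule finite_subset[of _ "{..<n}"]) (auto dest: edgeD)
  have row: "(\<Sum>j<n. Re (?L $$ (i, j)) * (x j * x i)) =
      (\<Sum>j\<in>?N i. (x i)\<^sup>2 - Re (\<phi> i j) * (x i * x j))" if i: "i < n" for i
  proof -
    have "(\<Sum>j<n. Re (?L $$ (i, j)) * (x j * x i)) =
        (\<Sum>j<n. (if i = j then real (vertex_degree E i) * (x i)\<^sup>2 else 0) -
          (if {i, j} \<in> E then Re (\<phi> i j) * (x i * x j) else 0))"
      using i by (intro sum.cong)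
        (auto simp: gain_laplacian_def degree_matrix_def gain_adjacency_def power2_eq_square algebra_simps)
    also have "\<dots> = real (vertex_degree E i) * (x i)\<^sup>2 -
        (\<Sum>j<n. if {i, j} \<in> E then Re (\<phi> i j) * (x i * x j) else 0)"
      using i by (simp add: sum_subtractf)
    also have "(\<Sum>j<n. if {i, j} \<in> E then Re (\<phi> i j) * (x i * x j) else 0) =
        (\<Sum>j\<in>?N i. Re (\<phi> i j) * (x i * x j))"
      by (rule sum.mono_neutral_cong_right) (auto dest: edgeD)
    finally show ?thesis by (simp add: vertex_degree_def sum_subtractf)
  qed
  have "Re ((?L *\<^sub>v v) \<bullet>c v) = (\<Sum>i<n. \<Sum>j<n. Re (?L $$ (i, j)) * (x j * x i))"
    by (subst mult_mat_vec_cscalar_prod[OF L]) (auto simp: v_def mult.assoc intro!: sum.cong)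
  also have "\<dots> = (\<Sum>i<n. \<Sum>j\<in>?N i. (x i)\<^sup>2 - Re (\<phi> i j) * (x i * x j))"
    by (rule sum.cong) (simp_all add: row)
  also have "\<dots> = (\<Sum>(i, j)\<in>(SIGMA i:{..<n}. ?N i). (x i)\<^sup>2 - Re (\<phi> i j) * (x i * x j))"
    by (rule sum.Sigma) (auto simp: fin)
  also have "(SIGMA i:{..<n}. ?N i) = arcs E" by (auto simp: arcs_def dest: edgeD)
  finally show ?thesis .
qed

lemma smallest_eigenvalue_gain_laplacian_le:
  fixes x :: "nat \<Rightarrow> real"
  shows "smallest_eigenvalue (gain_laplacian n E \<phi>) * (\<Sum>i<n. (x i)\<^sup>2) \<le>
    (\<Sum>(i, j)\<in>arcs E. (x i)\<^sup>2 - Re (\<phi> i j) * (x i * x j))"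
proof -
  let ?v = "vec n (\<lambda>i. complex_of_real (x i))"
  have "Re (?v \<bullet>c ?v) = (\<Sum>i<n. (x i)\<^sup>2)"
    by (subst cscalar_prod_self[of _ n]) auto
  then show ?thesis
    using smallest_eigenvalue_le_form[OF self_adjoint_gain_laplacian, of ?v]
    by (simp add: gain_laplacian_form)
qed

text \<open>The product form covers the empty edge set too, where both sides are 0.\<close>

lemma mean_gain_defect_eq:
  "card E * mean_gain_defect n E \<phi> = (\<Sum>(i, j)\<in>ascending_arcs E. 1 - Re (\<phi> i j))"
proof -
  have "{(i, j). i < j \<and> j < n \<and> {i, j} \<in> E} = ascending_arcs E"
    by (auto simp: ascending_arcs_def dest: edgeD)
  then have "mean_gain_defect n E \<phi> =
      1 / real (card E) * (\<Sum>(i, j)\<in>ascending_arcs E. 1 - Re (gain_adjacency n E \<phi> $$ (i, j)))"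
    by (simp add: mean_gain_defect_def)
  also have "(\<Sum>(i, j)\<in>ascending_arcs E. 1 - Re (gain_adjacency n E \<phi> $$ (i, j))) =
      (\<Sum>(i, j)\<in>ascending_arcs E. 1 - Re (\<phi> i j))"
    by (rule sum.cong) (auto simp: ascending_arcs_def gain_adjacency_def edgeD)
  finally show ?thesis
    using card_ascending_arcs finite_ascending_arcs by (cases "card E = 0") auto
qed

lemma sum_arcs_gain:
  "(\<Sum>(i, j)\<in>arcs E. Re (\<phi> i j)) = 2 * card E * (1 - mean_gain_defect n E \<phi>)"
proof -
  have "(\<Sum>(i, j)\<in>arcs E. Re (\<phi> i j)) = 2 * (\<Sum>(i, j)\<in>ascending_arcs E. Re (\<phi> i j))"
    by (rule sum_arcs) (simp add: gain_reverse_cnj)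
  also have "(\<Sum>(i, j)\<in>ascending_arcs E. Re (\<phi> i j)) = card E - card E * mean_gain_defect n E \<phi>"
    unfolding mean_gain_defect_eq
    by (simp add: case_prod_unfold sum_subtractf card_ascending_arcs)
  finally show ?thesis by (simp add: algebra_simps)
qed

lemma mean_gain_defect_bounds: "0 \<le> mean_gain_defect n E \<phi>" "mean_gain_defect n E \<phi> \<le> 2"
proof -
  have Re: "\<bar>Re (\<phi> i j)\<bar> \<le> 1" if "(i, j) \<in> ascending_arcs E" for i j
    using abs_Re_le_cmod[of "\<phi> i j"] gain_unit that by (simp add: ascending_arcs_def)
  have "0 \<le> card E * mean_gain_defect n E \<phi>"
    unfolding mean_gain_defect_eq using Re by (intro sum_nonneg) fastforce
  moreover have "card E * mean_gain_defect n E \<phi> \<le> (\<Sum>(i, j)\<in>ascending_arcs E. 2)"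
    unfolding mean_gain_defect_eq using Re by (intro sum_mono) fastforce
  then have "card E * mean_gain_defect n E \<phi> \<le> card E * 2"
    by (simp add: case_prod_unfold card_ascending_arcs)
  \<comment> \<open>Without edges the factor \<open>1 / 0\<close> is 0 by convention.\<close>
  moreover have "mean_gain_defect n E \<phi> = 0" if "card E = 0"
    using that by (simp add: mean_gain_defect_def)
  ultimately show "0 \<le> mean_gain_defect n E \<phi>" "mean_gain_defect n E \<phi> \<le> 2"
    by (cases "card E = 0"; force simp: zero_le_mult_iff)+
qed

section \<open>Test vectors: all ones, and one for each colour\<close>

lemma smallest_eigenvalue_le_mean_gain_defect:
  "smallest_eigenvalue (gain_laplacian n E \<phi>) * n \<le> 2 * card E * mean_gain_defect n E \<phi>"
  using smallest_eigenvalue_gain_laplacian_le[of "\<lambda>_. 1"] sum_arcs_gain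
  by (simp add: case_prod_unfold sum_subtractf card_arcs algebra_simps)

text \<open>
  One test vector for each colour: \<open>1 - K\<close> on its class and \<open>1\<close> elsewhere. Summed over the
  colours, the squares at a vertex give \<open>K (K - 1)\<close> and the products along an edge \<open>- K\<close>.
\<close>

lemma smallest_eigenvalue_le_colouring:
  assumes c: "proper_colouring n E K c" and K: "K > 0"
  shows "smallest_eigenvalue (gain_laplacian n E \<phi>) * n * (real K - 1) \<le>
    2 * card E * (K - mean_gain_defect n E \<phi>)"
proof -
  let ?l = "smallest_eigenvalue (gain_laplacian n E \<phi>)"
  define x where "x k i = 1 - (if c i = k then real K else 0)" for k i
  have colour: "c i < K" if "i < n" for i using c that by (simp add: proper_colouring_def)
  have square: "(\<Sum>k<K. (x k i)\<^sup>2) = real K * (real K - 1)" if "i < n" for i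
  proof -
    \<comment> \<open>\<open>(1 - K)\<^sup>2 = 1 + K (K - 2)\<close>, and exactly one colour
      \<open>k\<close> is that of \<open>i\<close>.\<close>
    have "(x k i)\<^sup>2 = 1 + (if c i = k then real K * (real K - 2) else 0)" for k
      by (simp add: x_def power2_eq_square algebra_simps)
    then show ?thesis using colour[OF that] by (simp add: sum.distrib algebra_simps)
  qed
  have product: "(\<Sum>k<K. x k i * x k j) = - real K" if "{i, j} \<in> E" for i j
  proof -
    \<comment> \<open>The ends of an edge have different colours, so no \<open>K\<^sup>2\<close>
      term occurs; summing over \<open>k\<close> leaves \<open>K - K - K\<close>.\<close>
    have "x k i * x k j = 1 - (if c i = k then real K else 0) - (if c j = k then real K else 0)" for k
    proof -
      have "c i \<noteq> c j" using c that by (simp add: proper_colouring_def)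
      then show ?thesis by (auto simp: x_def)
    qed
    then show ?thesis using colour edgeD[OF that] by (simp add: sum_subtractf)
  qed
  have "?l * (\<Sum>i<n. real K * (real K - 1)) = (\<Sum>k<K. ?l * (\<Sum>i<n. (x k i)\<^sup>2))"
    by (subst sum_distrib_left[symmetric], subst sum.swap) (simp add: square)
  also have "\<dots> \<le> (\<Sum>k<K. \<Sum>(i, j)\<in>arcs E. (x k i)\<^sup>2 - Re (\<phi> i j) * (x k i * x k j))"
    by (intro sum_mono smallest_eigenvalue_gain_laplacian_le)
  also have "\<dots> = (\<Sum>p\<in>arcs E. \<Sum>k<K. case p of (i, j) \<Rightarrow>
      (x k i)\<^sup>2 - Re (\<phi> i j) * (x k i * x k j))"
    by (rule sum.swap)
  also have "\<dots> = (\<Sum>(i, j)\<in>arcs E. real K * (real K - 1) + Re (\<phi> i j) * K)"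
    by (rule sum.cong) (auto simp: arcs_def sum_subtractf square product edgeD 
        simp flip: sum_distrib_left)
  also have "\<dots> = real (card (arcs E)) * (real K * (real K - 1)) +
      (\<Sum>(i, j)\<in>arcs E. Re (\<phi> i j)) * K"
    by (simp add: case_prod_unfold sum.distrib sum_distrib_right)
  \<comment> \<open>With \<open>m\<close> edges and mean defect \<open>a\<close>, this is
    \<open>2 m (K (K - 1) + K (1 - a)) = 2 m K (K - a)\<close>; the factor \<open>K\<close> cancels
    at the end.\<close>
  also have "\<dots> = K * (2 * card E * (K - mean_gain_defect n E \<phi>))"
    unfolding sum_arcs_gain card_arcs by (simp add: algebra_simps)
  finally have "real K * (?l * n * (real K - 1)) \<le> K * (2 * card E * (K - mean_gain_defect n E \<phi>))"
    by (simp add: mult_ac)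
  then show ?thesis using K by simp
qed

end

section \<open>Minimisation over \<gamma> and the final bounds\<close>

theorem theorem4p3:
  fixes n m \<chi> :: nat
    and E :: "nat set set"
    and \<phi> :: "nat \<Rightarrow> nat \<Rightarrow> complex"
    and a lam1 optimum :: real
    and bound :: "real \<Rightarrow> real"
  assumes graph: "unit_gain_graph n E \<phi>"
    and m: "m = card E" "m \<ge> 1"
    and chi: "\<chi> = chromatic_number n E"
    and a: "a = mean_gain_defect n E \<phi>"
    and lam1: "lam1 = smallest_eigenvalue (gain_laplacian n E \<phi>)"
    and bound: "bound = (\<lambda>\<gamma>. 2 * real m / real n *
                  (a - (\<gamma> - 1)\<^sup>2 * (a - 1) / (real \<chi> + \<gamma>\<^sup>2 - 1)))"
    and optimum: "optimum = (if a \<le> 1 then 2 * real m / real n * a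
                  else 2 * real m / real n * (1 - (a - 1) / (real \<chi> - 1)))"
  shows "(\<forall>\<gamma>. lam1 \<le> bound \<gamma>)
    \<and> 0 \<le> a \<and> a \<le> 2
    \<and> (\<exists>\<gamma>. bound \<gamma> = optimum) \<and> (\<forall>\<gamma>. optimum \<le> bound \<gamma>)
    \<and> lam1 \<le> optimum"
proof -
  interpret unit_gain_graph n E \<phi> by (rule graph)
  obtain e where e: "e \<in> E" using m by fastforce
  then obtain i j where ij: "{i, j} \<in> E" using edges by (metis card_2_iff)
  obtain c where c: "proper_colouring n E \<chi> c"
    using proper_colouring_chromatic_number chi by blast
  have "c i < \<chi>" "c j < \<chi>" "c i \<noteq> c j" using c ij edgeD[OF ij] by (auto simp: proper_colouring_def)
  \<comment> \<open>An edge forces two colours, so \<open>s\<close> is positive and the denominator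
    \<open>s + \<gamma>\<^sup>2\<close> never vanishes.\<close>
  then have chi2: "\<chi> \<ge> 2" by linarith
  define s where "s = real \<chi> - 1"
  have s: "s > 0" using chi2 by (simp add: s_def)
  have n: "real n > 0" using edgeD[OF ij] by simp
  have den: "s + \<gamma>\<^sup>2 > 0" for \<gamma> :: real using s by (simp add: add_pos_nonneg)
  have bound_s: "bound \<gamma> = 2 * m / n * (a - (\<gamma> - 1)\<^sup>2 * (a - 1) / (s + \<gamma>\<^sup>2))" for \<gamma>
    by (simp add: bound s_def algebra_simps)
  have least: "optimum \<le> bound \<gamma>" for \<gamma>
  proof (cases "a \<le> 1")
    case True
    then have "(\<gamma> - 1)\<^sup>2 * (a - 1) / (s + \<gamma>\<^sup>2) \<le> 0"
      using den[of \<gamma>] by (simp add: divide_nonpos_pos mult_nonneg_nonpos)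
    then show ?thesis using True unfolding optimum bound_s
      by (auto intro!: mult_left_mono simp del: times_divide_eq_left)
  next
    case False
    \<comment> \<open>This square is exactly the difference of the two sides of the next inequality,
      so equality holds only at \<open>\<gamma> = - s\<close>.\<close>
    have "0 \<le> (\<gamma> + s)\<^sup>2" by simp
    then have "s * (\<gamma> - 1)\<^sup>2 \<le> (s + 1) * (s + \<gamma>\<^sup>2)"
      by (simp add: power2_eq_square algebra_simps)
    then have "(\<gamma> - 1)\<^sup>2 / (s + \<gamma>\<^sup>2) \<le> (s + 1) / s"
      using s den[of \<gamma>] by (simp add: divide_le_eq pos_le_divide_eq field_simps)
    then have "(\<gamma> - 1)\<^sup>2 / (s + \<gamma>\<^sup>2) * (a - 1) \<le> (s + 1) / s * (a - 1)"
      using False by (intro mult_right_mono) auto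
    also have "\<dots> = a - (1 - (a - 1) / s)" using s by (simp add: field_simps)
    finally have "1 - (a - 1) / s \<le> a - (\<gamma> - 1)\<^sup>2 * (a - 1) / (s + \<gamma>\<^sup>2)" by simp
    then have "2 * m / n * (1 - (a - 1) / s) \<le> bound \<gamma>"
      unfolding bound_s by (intro mult_left_mono) auto
    then show ?thesis using False by (simp add: optimum s_def)
  qed
  have attained: "\<exists>\<gamma>. bound \<gamma> = optimum"
  proof (cases "a \<le> 1")
    case True
    \<comment> \<open>At \<open>\<gamma> = 1\<close> the subtracted term, which is never positive in
      this case, vanishes.\<close>
    then have "bound 1 = optimum" by (simp add: bound optimum)
    then show ?thesis ..
  next
    case False
    have "s + (- s)\<^sup>2 = s * (s + 1)" "(- s - 1)\<^sup>2 = (s + 1) * (s + 1)"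
      by (simp_all add: power2_eq_square algebra_simps)
    then have "bound (- s) = 2 * m / n * (a - (s + 1) * (s + 1) * (a - 1) / (s * (s + 1)))"
      by (simp add: bound_s)
    also have "(s + 1) * (s + 1) * (a - 1) / (s * (s + 1)) = (s + 1) * (a - 1) / s"
      using s by (simp add: divide_simps)
    also have "a - (s + 1) * (a - 1) / s = 1 - (a - 1) / s"
      using s by (simp add: field_simps)
    finally have "bound (- s) = optimum" using False by (simp add: optimum s_def)
    then show ?thesis ..
  qed
  have upper: "lam1 \<le> optimum"
  proof (cases "a \<le> 1")
    case True
    then show ?thesis
      using smallest_eigenvalue_le_mean_gain_defect n by (simp add: optimum lam1 a m field_simps)
  next
    case False
    \<comment> \<open>The colouring bound with \<open>K = \<chi> = s + 1\<close>; dividing by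
      \<open>n s\<close> gives the optimum since \<open>s + 1 - a = s - (a - 1)\<close>.\<close>
    have "lam1 * n * s \<le> 2 * m * (s + 1 - a)"
      using smallest_eigenvalue_le_colouring[OF c] chi2 by (simp add: lam1 a m s_def)
    then have "lam1 \<le> 2 * m * (s + 1 - a) / (n * s)" using s n by (simp add: pos_le_divide_eq mult.assoc)
    also have "\<dots> = 2 * m / n * (1 - (a - 1) / s)" using s n by (simp add: field_simps)
    finally show ?thesis using False by (simp add: optimum s_def)
  qed
  show ?thesis
    \<comment> \<open>The bound for each \<gamma> follows from the optimal one, which lies below
      it.\<close>
    using least attained upper mean_gain_defect_bounds order_trans[OF upper least] by (simp add: a)
qed

end
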